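(* Let $X\in\mathbb{R}^m$ be a fixed vector, let $\sigma>0$, and let $Y\sim N(0,\sigma^2I_m)$. Then for every $\varepsilon\ge 0$, $$\mathbb P(\|X+Y\|_2>\varepsilon)=\mathcal Q_{m/2}^{ma}\left(\frac{\|X\|_2}{\sigma},\frac{\varepsilon}{\sigma}\right).$$
   Context: $N(0,\sigma^2I_m)$ is the centered Gaussian distribution on $\mathbb{R}^m$ with covariance $\sigma^2I_m$. For real $\nu$, the modified Bessel function of the first kind of order $\nu$ is $\mathcal I_\nu(t)=\sum_{j\ge0}\frac{(t/2)^{2j+\nu}}{j!\,\Gamma(\nu+j+1)}$. The generalized Marcum-Q function is defined, for $\beta\ge0$ and $\alpha,M>0$, by $$\mathcal Q_M^{ma}(\alpha,\beta)=\frac{1}{\alpha^{M-1}}\int_\beta^\infty x^M\exp\left(-\frac{x^2+\alpha^2}{2}\right)\mathcal I_{M-1}(\alpha x)\,dx,$$ and for $\alpha=0$ by $\mathcal Q_M^{ma}(0,\beta)=\Gamma(M,\beta^2/2)/\Gamma(M)$, where $\Gamma(s,t)=\int_t^\infty u^{s-1}e^{-u}\,du$ is the upper incomplete gamma function. *)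

theory Defs
  imports "HOL-Probability.Probability"
begin

text \<open>
  Density of the Gaussian distribution with mean \<open>\<mu>\<close> and covariance matrix \<open>\<Sigma>\<close>
  with respect to Lebesgue measure; meaningful for symmetric positive definite \<open>\<Sigma>\<close>.
\<close>

definition multivariate_normal_density ::
  "real ^ 'm \<Rightarrow> real ^ 'm ^ 'm \<Rightarrow> real ^ 'm \<Rightarrow> real" where
  "multivariate_normal_density \<mu> \<Sigma> x =
     exp (- ((x - \<mu>) \<bullet> (matrix_inv \<Sigma> *v (x - \<mu>))) / 2) /
     sqrt ((2 * pi) ^ CARD('m) * det \<Sigma>)"

text \<open>
  For covariance \<open>\<sigma>\<^sup>2 I\<close> this is the joint density of independent one-dimensional
  \<open>N(0, \<sigma>\<^sup>2)\<close> coordinates.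
\<close>

lemma multivariate_normal_density_isotropic:
  fixes x :: "real ^ 'm"
  assumes "\<sigma> > 0"
  shows "multivariate_normal_density 0 (\<sigma>\<^sup>2 *\<^sub>R mat 1) x =
    (\<Prod>i\<in>UNIV. normal_density 0 \<sigma> (x $ i))"
proof -
  let ?S = "\<sigma>\<^sup>2 *\<^sub>R mat 1 :: real ^ 'm ^ 'm"
  have S: "?S = mat (\<sigma>\<^sup>2)"
    by (simp add: mat_def vec_eq_iff)
  have det: "det ?S = (\<sigma>\<^sup>2) ^ CARD('m)"
    unfolding S by (metis det_matrix_scaleR matrix_scaleR)
  then have "invertible ?S"
    using assms by (simp add: invertible_det_nz)
  then have "?S ** matrix_inv ?S = mat 1"
    unfolding invertible_def matrix_inv_def by (rule someI2_ex) simp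
  then have "?S *v (matrix_inv ?S *v x) = x"
    by (simp add: matrix_vector_mul_assoc)
  moreover have "?S *v (matrix_inv ?S *v x) = \<sigma>\<^sup>2 *\<^sub>R (matrix_inv ?S *v x)"
    by (simp add: scaleR_matrix_vector_assoc[symmetric])
  ultimately have "(1 / \<sigma>\<^sup>2) *\<^sub>R (\<sigma>\<^sup>2 *\<^sub>R (matrix_inv ?S *v x)) = (1 / \<sigma>\<^sup>2) *\<^sub>R x"
    by simp
  then have inv: "matrix_inv ?S *v x = (1 / \<sigma>\<^sup>2) *\<^sub>R x"
    using assms by simp
  have "(\<Prod>i\<in>UNIV. normal_density 0 \<sigma> (x $ i)) =
      exp (\<Sum>i\<in>UNIV. - (x $ i)\<^sup>2 / (2 * \<sigma>\<^sup>2)) / sqrt (2 * pi * \<sigma>\<^sup>2) ^ CARD('m)"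
    by (simp add: normal_density_def exp_sum prod_dividef)
  also have "(\<Sum>i\<in>UNIV. - (x $ i)\<^sup>2 / (2 * \<sigma>\<^sup>2)) = - (x \<bullet> x) / (2 * \<sigma>\<^sup>2)"
    by (simp add: inner_vec_def power2_eq_square sum_divide_distrib sum_negf)
  finally show ?thesis
    by (simp add: multivariate_normal_density_def det inv real_sqrt_power power_mult_distrib
        real_sqrt_mult mult.commute)
qed

text \<open>
  Real powers with the convention \<open>t\<^sup>0 = 1\<close>; it is needed because \<open>0 powr 0 = 0\<close>,
  whereas the leading term of \<open>I\<^sub>0\<close> at the origin is \<open>1\<close>.
\<close>

definition rpow :: "real \<Rightarrow> real \<Rightarrow> real" where
  "rpow t a = (if a = 0 then 1 else t powr a)"

text \<open>
  The modified Bessel function of the first kind of real order \<open>\<nu>\<close>, for \<open>t \<ge> 0\<close>.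
  The reciprocal Gamma function vanishes at the poles of \<open>\<Gamma>\<close>.
  For \<open>t = 0\<close> and negative non-integer \<open>\<nu>\<close> the series is not defined; the value there is
  an artefact of \<open>powr\<close>.
\<close>

definition bessel_I :: "real \<Rightarrow> real \<Rightarrow> real" where
  "bessel_I \<nu> t =
     (\<Sum>j. rpow (t / 2) (2 * real j + \<nu>) * rGamma (\<nu> + real j + 1) / fact j)"

definition upper_incomplete_Gamma :: "real \<Rightarrow> real \<Rightarrow> real" where
  "upper_incomplete_Gamma s t = (LBINT u:{t..}. u powr (s - 1) * exp (- u))"

definition marcum_Q :: "real \<Rightarrow> real \<Rightarrow> real \<Rightarrow> real" where
  "marcum_Q M \<alpha> \<beta> =
     (if \<alpha> = 0 then upper_incomplete_Gamma M (\<beta>\<^sup>2 / 2) / Gamma M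
      else 1 / \<alpha> powr (M - 1) *
        (LBINT x:{\<beta>..}. x powr M * exp (- (x\<^sup>2 + \<alpha>\<^sup>2) / 2) * bessel_I (M - 1) (\<alpha> * x)))"

end

theory Submission
  imports Defs
begin

text \<open>
  Put \<open>W\<^sub>i = ((X\<^sub>i + Y\<^sub>i) / \<sigma>)\<^sup>2 / 2\<close>, so that \<open>\<parallel>X + Y\<parallel>\<^sup>2 / (2 \<sigma>\<^sup>2)\<close> is the sum of the independent
  variables \<open>W\<^sub>i\<close>. Each \<open>W\<^sub>i\<close> has a noncentral Gamma distribution, that is, a mixture of the
  Gamma distributions of shapes \<open>1/2 + j\<close> with Poisson weights in \<open>j\<close> of parameter
  \<open>(X\<^sub>i / \<sigma>)\<^sup>2 / 2\<close>; this is the Taylor series of the \<open>cosh\<close> in the folded normal density. Such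
  mixtures are closed under convolution: the shapes add by the Beta integral and the Poisson
  parameters by the binomial theorem. The resulting density of shape \<open>m/2\<close> is, after the
  substitution \<open>w = x\<^sup>2 / 2\<close>, the integrand of the Marcum function with the Bessel series
  written out.
\<close>

section \<open>Substitution by half the square on the positive half-line\<close>

text \<open>\<open>nn_integral_substitution\<close> is applied on the compact intervals from 0 to
  \<open>n\<close>, and monotone convergence in \<open>n\<close> extends the identity to the
  half-line. Open and closed half-lines differ by the null set of the origin.\<close>

lemma nn_integral_half_square_substitution:
  fixes f :: "real \<Rightarrow> real"
  assumes [measurable]: "f \<in> borel_measurable borel" and nonneg: "\<And>x. f x \<ge> 0"
  shows "(\<integral>\<^sup>+x. ennreal (f x) * indicator {0<..} x \<partial>lborel) =
    (\<integral>\<^sup>+x. ennreal (f (x\<^sup>2 / 2) * x) * indicator {0<..} x \<partial>lborel)"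
proof -
  let ?F = "\<lambda>n::nat. \<lambda>x. ennreal (f x) * indicator {0..(real n)\<^sup>2 / 2} x"
  let ?G = "\<lambda>n::nat. \<lambda>x. ennreal (f (x\<^sup>2 / 2) * x) * indicator {0..real n} x"
  have ind: "indicator {0..a} x \<le> (indicator {0..b} x :: ennreal)" if "a \<le> b" for a b x :: real
    using that by (auto simp: indicator_def)
  have incF: "incseq ?F"
  proof (intro incseq_SucI le_funI)
    fix n x
    have "(real n)\<^sup>2 / 2 \<le> (real (Suc n))\<^sup>2 / 2" by (simp add: power2_eq_square mult_mono)
    then show "?F n x \<le> ?F (Suc n) x"
      by (intro mult_left_mono ind) auto
  qed
  have incG: "incseq ?G"
    by (intro incseq_SucI le_funI mult_left_mono) (auto simp: indicator_def)
  have supF: "(SUP n. ?F n x) = ennreal (f x) * indicator {0..} x" for x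
  proof (intro antisym SUP_least)
    show "?F n x \<le> ennreal (f x) * indicator {0..} x" for n
      by (intro mult_left_mono) (auto simp: indicator_def)
    \<comment> \<open>For \<open>x \<ge> 0\<close> this gives both \<open>1 \<le> n\<close> and
      \<open>2 * x \<le> n\<close>, whose product is the bound needed for \<open>x\<close> to lie
      below \<open>n\<close> squared over 2.\<close>
    obtain n :: nat where n: "2 * x + 1 \<le> real n" using real_arch_simple by blast
    show "ennreal (f x) * indicator {0..} x \<le> (SUP n. ?F n x)"
    proof (cases "x \<ge> 0")
      case True
      have "1 * (2 * x) \<le> real n * real n" using n True by (intro mult_mono) auto
      then have "x \<le> (real n)\<^sup>2 / 2" by (simp add: power2_eq_square)
      then have "ennreal (f x) * indicator {0..} x \<le> ?F n x" using True by simp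
      also have "\<dots> \<le> (SUP n. ?F n x)" by (rule SUP_upper) simp
      finally show ?thesis .
    qed simp
  qed
  have supG: "(SUP n. ?G n x) = ennreal (f (x\<^sup>2 / 2) * x) * indicator {0..} x" for x
  proof (intro antisym SUP_least)
    show "?G n x \<le> ennreal (f (x\<^sup>2 / 2) * x) * indicator {0..} x" for n
      by (intro mult_left_mono) (auto simp: indicator_def)
    obtain n :: nat where n: "x \<le> real n" using real_arch_simple by blast
    then have "ennreal (f (x\<^sup>2 / 2) * x) * indicator {0..} x \<le> ?G n x"
      by (intro mult_left_mono) (auto simp: indicator_def)
    also have "\<dots> \<le> (SUP n. ?G n x)" by (rule SUP_upper) simp
    finally show "ennreal (f (x\<^sup>2 / 2) * x) * indicator {0..} x \<le> (SUP n. ?G n x)" .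
  qed
  have "integral\<^sup>N lborel (?F n) = integral\<^sup>N lborel (?G n)" for n
  proof -
    \<comment> \<open>The lower endpoint is written as the image of 0 under half the square, the
      shape that the substitution rule expects.\<close>
    have "integral\<^sup>N lborel (?F n) = (\<integral>\<^sup>+x. ennreal (f x * indicator {0\<^sup>2 / 2..(real n)\<^sup>2 / 2} x) \<partial>lborel)"
      by (intro nn_integral_cong) (auto simp: indicator_def)
    also have "\<dots> = (\<integral>\<^sup>+x. ennreal (f (x\<^sup>2 / 2) * x * indicator {0..real n} x) \<partial>lborel)"
      by (rule nn_integral_substitution[where g = "\<lambda>x. x\<^sup>2 / 2" and g' = "\<lambda>x. x"])
        (auto intro!: derivative_eq_intros continuous_intros simp: set_borel_measurable_def)
    also have "\<dots> = integral\<^sup>N lborel (?G n)"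
      by (intro nn_integral_cong) (auto simp: indicator_def)
    finally show ?thesis .
  qed
  then have "(SUP n. integral\<^sup>N lborel (?F n)) = (SUP n. integral\<^sup>N lborel (?G n))" by simp
  then have eq: "(\<integral>\<^sup>+x. ennreal (f x) * indicator {0..} x \<partial>lborel) =
      (\<integral>\<^sup>+x. ennreal (f (x\<^sup>2 / 2) * x) * indicator {0..} x \<partial>lborel)"
    using nn_integral_monotone_convergence_SUP[OF incF, of lborel]
      nn_integral_monotone_convergence_SUP[OF incG, of lborel]
    by (simp add: supF supG)
  have ae: "AE x in lborel. x \<noteq> (0::real)" by (rule AE_lborel_singleton)
  have "(\<integral>\<^sup>+x. h x * indicator {0<..} x \<partial>lborel) = (\<integral>\<^sup>+x. h x * indicator {0..} x \<partial>lborel)"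
    for h :: "real \<Rightarrow> ennreal"
    using ae by (intro nn_integral_cong_AE) (auto elim!: eventually_mono simp: indicator_def)
  with eq show ?thesis by simp
qed

section \<open>Gamma densities and the Beta integral\<close>

text \<open>The Gamma law of shape \<open>k\<close> and rate 1. At the origin, a null set, the value
  is 0 for every shape, so the density lives on \<open>y > 0\<close> only.\<close>

definition gamma_density :: "real \<Rightarrow> real \<Rightarrow> real" where
  "gamma_density k y = (if y > 0 then y powr (k - 1) * exp (- y) / Gamma k else 0)"

lemma borel_measurable_gamma_density [measurable]: "gamma_density k \<in> borel_measurable borel"
  unfolding gamma_density_def by measurable

lemma gamma_density_nonneg: "k > 0 \<Longrightarrow> gamma_density k y \<ge> 0"
  by (auto simp: gamma_density_def intro!: divide_nonneg_pos Gamma_real_pos)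

text \<open>For \<open>x > 0\<close> the scaling \<open>y = x * t\<close> turns the convolution into
  a Beta integral over the unit interval: the two exponentials multiply to \<open>exp (- x)\<close>,
  and \<open>Beta l k\<close> replaces the two Gamma factors by \<open>Gamma (k + l)\<close>. For
  \<open>x \<le> 0\<close> one of the two arguments is always nonpositive.\<close>

lemma gamma_density_convolution:
  assumes "k > 0" "l > 0"
  shows "(\<integral>\<^sup>+y. ennreal (gamma_density k (x - y)) * ennreal (gamma_density l y) \<partial>lborel) =
    ennreal (gamma_density (k + l) x)"
proof (cases "x > 0")
  case False
  then have "(\<integral>\<^sup>+y. ennreal (gamma_density k (x - y)) * ennreal (gamma_density l y) \<partial>lborel) =
    (\<integral>\<^sup>+y. 0 \<partial>(lborel :: real measure))"
    by (intro nn_integral_cong) (auto simp: gamma_density_def)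
  with False show ?thesis by (simp add: gamma_density_def)
next
  case True
  \<comment> \<open>Everything free of \<open>t\<close> after the scaling. The exponent is
    \<open>(k - 1) + (l - 1)\<close>; the Jacobian \<open>x\<close> later raises it to
    \<open>k + l - 1\<close>.\<close>
  let ?C = "x powr (k + l - 2) * exp (- x) / (Gamma k * Gamma l)"
  let ?b = "\<lambda>t. t powr (l - 1) * (1 - t) powr (k - 1)"
  have pos: "Gamma k > 0" "Gamma l > 0" "Gamma (k + l) > 0"
    using assms by (auto intro: Gamma_real_pos)
  then have nn: "0 \<le> ?C" "0 \<le> Beta l k" by (auto simp: Beta_def add.commute)
  have "(\<integral>\<^sup>+y. ennreal (gamma_density k (x - y)) * ennreal (gamma_density l y) \<partial>lborel) =
    ennreal \<bar>x\<bar> * (\<integral>\<^sup>+t. ennreal (gamma_density k (x - (0 + x * t))) * ennreal (gamma_density l (0 + x * t)) \<partial>lborel)"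
    using True by (intro nn_integral_real_affine) auto
  also have "(\<integral>\<^sup>+t. ennreal (gamma_density k (x - (0 + x * t))) * ennreal (gamma_density l (0 + x * t)) \<partial>lborel)
     = (\<integral>\<^sup>+t. ennreal ?C * ennreal (indicator {0..1} t * ?b t) \<partial>lborel)"
  \<comment> \<open>Discarding the endpoints 0 and 1 leaves the open unit interval, where all powers
    have positive base, and its exterior, where both sides vanish.\<close>
  proof (intro nn_integral_cong_AE eventually_mono[OF eventually_conj[OF AE_lborel_singleton[of 0] AE_lborel_singleton[of 1]]])
    fix t :: real
    assume t: "t \<noteq> 0 \<and> t \<noteq> 1"
    have sub: "x - x * t = x * (1 - t)" by (simp add: algebra_simps)
    show "ennreal (gamma_density k (x - (0 + x * t))) * ennreal (gamma_density l (0 + x * t)) =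
      ennreal ?C * ennreal (indicator {0..1} t * ?b t)"
    proof (cases "0 < t \<and> t < 1")
      case 1: True
      have e: "gamma_density k (x * (1 - t)) * gamma_density l (x * t) = ?C * ?b t"
      proof -
        have "x powr (k + l - 2) = x powr (k - 1) * x powr (l - 1)"
          by (simp add: powr_add[symmetric])
        moreover have "exp (- (x * (1 - t))) * exp (- (x * t)) = exp (- x)"
          by (simp add: exp_add[symmetric] algebra_simps)
        moreover have "gamma_density k (x * (1 - t)) * gamma_density l (x * t) =
            (x powr (k - 1) * x powr (l - 1)) * (exp (- (x * (1 - t))) * exp (- (x * t))) /
            (Gamma k * Gamma l) * ?b t"
          using 1 True by (simp add: gamma_density_def powr_mult mult_ac)
        ultimately show ?thesis by simp
      qed
      have "0 \<le> ?C" "0 \<le> ?b t" using pos by auto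
      then show ?thesis
        using 1 gamma_density_nonneg[OF assms(1)] gamma_density_nonneg[OF assms(2)] e
        by (simp add: sub ennreal_mult[symmetric])
    next
      case False
      then show ?thesis
        using t True
        by (auto simp: gamma_density_def sub zero_less_mult_iff indicator_def)
    qed
  qed
  also have "\<dots> = ennreal ?C * (\<integral>\<^sup>+t. ennreal (indicator {0..1} t * ?b t) \<partial>lborel)"
    by (rule nn_integral_cmult) measurable
  also have "(\<integral>\<^sup>+t. ennreal (indicator {0..1} t * ?b t) \<partial>lborel) = ennreal (Beta l k)"
    by (rule nn_integral_has_integral_lebesgue[OF _ has_integral_Beta_real]) (use assms in auto)
  also have "ennreal \<bar>x\<bar> * (ennreal ?C * ennreal (Beta l k)) = ennreal (\<bar>x\<bar> * (?C * Beta l k))"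
    by (simp only: ennreal_mult[OF nn] ennreal_mult[OF abs_ge_zero mult_nonneg_nonneg[OF nn]])
  also have "\<bar>x\<bar> * (?C * Beta l k) = gamma_density (k + l) x"
  proof -
    have "x powr (k + l - 1) = x * x powr (k + l - 2)"
      using True powr_mult_base[of x "k + l - 2"] by simp
    then show ?thesis
      using True pos by (simp add: gamma_density_def Beta_def add.commute)
  qed
  finally show ?thesis .
qed

section \<open>Poisson mixtures of Gamma densities\<close>

text \<open>When \<open>2 * M\<close> is a positive integer, this is the law of half a noncentral
  chi-square variable with \<open>2 * M\<close> degrees of freedom and noncentrality
  \<open>2 * \<theta>\<close>.\<close>

definition noncentral_gamma_density :: "real \<Rightarrow> real \<Rightarrow> real \<Rightarrow> real" where
  "noncentral_gamma_density M \<theta> y = (\<Sum>j. exp (- \<theta>) * \<theta> ^ j / fact j * gamma_density (M + real j) y)"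

lemma borel_measurable_noncentral_gamma_density [measurable]: "noncentral_gamma_density M \<theta> \<in> borel_measurable borel"
  unfolding noncentral_gamma_density_def by measurable

text \<open>Ratio test: consecutive terms have ratio \<open>K / ((n + 1) * (M + n))\<close>. The
  same series underlies the mixture density and the Bessel function.\<close>

lemma summable_power_div_fact_Gamma:
  fixes M K :: real
  assumes "M > 0" "K \<ge> 0"
  shows "summable (\<lambda>j. K ^ j / (fact j * Gamma (M + real j)))"
proof -
  \<comment> \<open>From this index on,
    \<open>(n + 1) * (M + n) \<ge> (n + 1) * M \<ge> 2 * K\<close>, so the ratio is at most
    1/2.\<close>
  obtain N :: nat where N: "2 * K / M \<le> real N" using real_arch_simple by blast
  have nn: "0 \<le> K ^ m / (fact m * Gamma (M + real m))" for m
    using assms Gamma_real_pos[of "M + real m"] by simp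
  show ?thesis
  proof (rule summable_ratio_test[where c = "1 / 2" and N = N])
    fix n assume "n \<ge> N"
    have G: "Gamma (M + real n) > 0" using assms by (intro Gamma_real_pos) auto
    have rec: "Gamma (M + real (Suc n)) = (M + real n) * Gamma (M + real n)"
      using Gamma_plus1[of "M + real n"] assms nonpos_Ints_nonpos[of "M + real n"]
      by (force simp: add_ac)
    have "2 * K / M \<le> real n + 1" using N \<open>n \<ge> N\<close> by linarith
    then have "2 * K \<le> (real n + 1) * M" using assms by (simp add: field_simps)
    also have "\<dots> \<le> (real n + 1) * (M + real n)" by (intro mult_left_mono) auto
    finally have "2 * K \<le> (real n + 1) * (M + real n)" .
    moreover have "0 < (real n + 1) * (M + real n)" using assms by (intro mult_pos_pos) auto
    ultimately have "K / ((real n + 1) * (M + real n)) \<le> 1 / 2"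
      by (simp only: pos_divide_le_eq)
    then have "K / ((real n + 1) * (M + real n)) * (K ^ n / (fact n * Gamma (M + real n)))
      \<le> 1 / 2 * (K ^ n / (fact n * Gamma (M + real n)))"
      using G assms by (intro mult_right_mono) auto
    also have "K / ((real n + 1) * (M + real n)) * (K ^ n / (fact n * Gamma (M + real n))) =
      K ^ Suc n / (fact (Suc n) * Gamma (M + real (Suc n)))"
      unfolding rec by (simp add: mult_ac add_ac)
    finally show "norm (K ^ Suc n / (fact (Suc n) * Gamma (M + real (Suc n)))) \<le>
      1 / 2 * norm (K ^ n / (fact n * Gamma (M + real n)))"
      by (simp only: real_norm_def abs_of_nonneg[OF nn])
  qed simp
qed

text \<open>Collects the dependence on \<open>j\<close> in a power series in the single variable
  \<open>\<theta> * y\<close>, which can then be compared with \<open>cosh\<close> and with the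
  Bessel series.\<close>

lemma noncentral_gamma_density_term:
  assumes "y > 0" "M > 0"
  shows "exp (- \<theta>) * \<theta> ^ j / fact j * gamma_density (M + real j) y =
     exp (- \<theta>) * exp (- y) * y powr (M - 1) * ((\<theta> * y) ^ j / (fact j * Gamma (M + real j)))"
proof -
  have "y powr (M + real j - 1) = y powr (M - 1) * y ^ j"
    using assms by (simp add: powr_add[symmetric] powr_realpow[symmetric] algebra_simps)
  then show ?thesis using assms by (simp add: gamma_density_def power_mult_distrib)
qed

lemma summable_noncentral_gamma_density:
  assumes "M > 0" "\<theta> \<ge> 0"
  shows "summable (\<lambda>j. exp (- \<theta>) * \<theta> ^ j / fact j * gamma_density (M + real j) y)"
proof (cases "y > 0")
  case True
  then show ?thesis
    unfolding noncentral_gamma_density_term[OF True assms(1)]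
    using assms by (intro summable_mult summable_power_div_fact_Gamma) auto
qed (simp add: gamma_density_def)

lemma noncentral_gamma_density_term_nonneg:
  assumes "M > 0" "\<theta> \<ge> 0"
  shows "exp (- \<theta>) * \<theta> ^ j / fact j * gamma_density (M + real j) y \<ge> 0"
  using assms by (intro mult_nonneg_nonneg gamma_density_nonneg) auto

lemma noncentral_gamma_density_nonneg: "M > 0 \<Longrightarrow> \<theta> \<ge> 0 \<Longrightarrow> noncentral_gamma_density M \<theta> y \<ge> 0"
  unfolding noncentral_gamma_density_def by (intro suminf_nonneg summable_noncentral_gamma_density noncentral_gamma_density_term_nonneg)

lemma noncentral_gamma_density_nonpos: "y \<le> 0 \<Longrightarrow> noncentral_gamma_density M \<theta> y = 0"
  by (simp add: noncentral_gamma_density_def gamma_density_def)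

lemma noncentral_gamma_density_pos:
  assumes "y > 0" "M > 0" "\<theta> \<ge> 0"
  shows "noncentral_gamma_density M \<theta> y = exp (- \<theta>) * exp (- y) * y powr (M - 1) *
    (\<Sum>j. (\<theta> * y) ^ j / (fact j * Gamma (M + real j)))"
  unfolding noncentral_gamma_density_def noncentral_gamma_density_term[OF assms(1,2)]
  using assms by (intro suminf_mult summable_power_div_fact_Gamma) auto

text \<open>In \<open>ennreal\<close> the mixture can be integrated term by term and rearranged
  freely.\<close>

lemma ennreal_noncentral_gamma_density:
  assumes "M > 0" "\<theta> \<ge> 0"
  shows "ennreal (noncentral_gamma_density M \<theta> y) =
    (\<Sum>j. ennreal (exp (- \<theta>) * \<theta> ^ j / fact j) * ennreal (gamma_density (M + real j) y))"
proof -
  have "ennreal (noncentral_gamma_density M \<theta> y) =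
    (\<Sum>j. ennreal (exp (- \<theta>) * \<theta> ^ j / fact j * gamma_density (M + real j) y))"
    unfolding noncentral_gamma_density_def
    by (intro suminf_ennreal2[symmetric] noncentral_gamma_density_term_nonneg summable_noncentral_gamma_density assms)
  moreover have "ennreal (exp (- \<theta>) * \<theta> ^ j / fact j * gamma_density (M + real j) y) =
      ennreal (exp (- \<theta>) * \<theta> ^ j / fact j) * ennreal (gamma_density (M + real j) y)" for j
    using assms by (intro ennreal_mult gamma_density_nonneg) auto
  ultimately show ?thesis by simp
qed

section \<open>Double series and the convolution of mixtures\<close>

text \<open>Tonelli, with one of the two sums read as an integral over counting measure.\<close>

lemma suminf_swap_ennreal:
  fixes f :: "nat \<Rightarrow> nat \<Rightarrow> ennreal"
  shows "(\<Sum>i. \<Sum>j. f i j) = (\<Sum>j. \<Sum>i. f i j)"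
  using nn_integral_suminf[of f "count_space UNIV"] by (simp add: nn_integral_count_space_nat)

text \<open>The inner series is shifted by \<open>i\<close> and padded with zeros, so that its index
  becomes the total \<open>n = i + j\<close>; after the swap only \<open>i \<le> n\<close>
  contributes.\<close>

lemma suminf_antidiagonal_ennreal:
  fixes f :: "nat \<Rightarrow> nat \<Rightarrow> ennreal"
  shows "(\<Sum>i. \<Sum>j. f i j) = (\<Sum>n. \<Sum>i\<le>n. f i (n - i))"
proof -
  have "(\<Sum>j. f i j) = (\<Sum>n. if i \<le> n then f i (n - i) else 0)" for i
    using suminf_offset[of "\<lambda>n. if i \<le> n then f i (n - i) else 0" i] by simp
  then have "(\<Sum>i. \<Sum>j. f i j) = (\<Sum>i. \<Sum>n. if i \<le> n then f i (n - i) else 0)" by simp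
  also have "\<dots> = (\<Sum>n. \<Sum>i. if i \<le> n then f i (n - i) else 0)" by (rule suminf_swap_ennreal)
  also have "\<dots> = (\<Sum>n. \<Sum>i\<le>n. f i (n - i))"
  proof (intro suminf_cong)
    show "(\<Sum>i. if i \<le> n then f i (n - i) else 0) = (\<Sum>i\<le>n. f i (n - i))" for n
      by (subst suminf_finite[of "{..n}"]) auto
  qed
  finally show ?thesis .
qed

text \<open>The binomial theorem divided by \<open>fact n\<close>; in probabilistic terms, a sum of
  independent Poisson variables is Poisson.\<close>

lemma poisson_weights_convolution:
  fixes \<theta> \<mu> :: real
  shows "(\<Sum>i\<le>n. exp (- \<theta>) * \<theta> ^ i / fact i * (exp (- \<mu>) * \<mu> ^ (n - i) / fact (n - i))) =
    exp (- (\<theta> + \<mu>)) * (\<theta> + \<mu>) ^ n / fact n"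
proof -
  have "(\<theta> + \<mu>) ^ n / fact n = (\<Sum>i\<le>n. (of_nat (n choose i) * \<theta> ^ i * \<mu> ^ (n - i)) / fact n)"
    by (simp add: binomial_ring sum_divide_distrib)
  also have "\<dots> = (\<Sum>i\<le>n. \<theta> ^ i / fact i * (\<mu> ^ (n - i) / fact (n - i)))"
    by (intro sum.cong) (auto simp: binomial_fact field_simps)
  finally have "exp (- (\<theta> + \<mu>)) * ((\<theta> + \<mu>) ^ n / fact n) =
     (\<Sum>i\<le>n. exp (- (\<theta> + \<mu>)) * (\<theta> ^ i / fact i * (\<mu> ^ (n - i) / fact (n - i))))"
    by (simp add: sum_distrib_left)
  moreover have "exp (- (\<theta> + \<mu>)) = exp (- \<theta>) * exp (- \<mu>)" by (simp add: exp_add[symmetric])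
  ultimately show ?thesis by (simp add: mult_ac)
qed

text \<open>Nonnegativity lets the integral pass through the double series. The Gamma density
  obtained for the pair \<open>i\<close>, \<open>j\<close> depends on \<open>i + j\<close> only, so
  grouping by this total leaves a sum of products of Poisson weights.\<close>

lemma noncentral_gamma_density_convolution:
  assumes "M > 0" "N > 0" "\<theta> \<ge> 0" "\<mu> \<ge> 0"
  shows "(\<integral>\<^sup>+y. ennreal (noncentral_gamma_density M \<theta> (x - y)) * ennreal (noncentral_gamma_density N \<mu> y) \<partial>lborel) =
    ennreal (noncentral_gamma_density (M + N) (\<theta> + \<mu>) x)"
proof -
  define p where "p \<theta> j = exp (- \<theta>) * \<theta> ^ j / fact j" for \<theta> :: real and j
  have p: "p \<theta> j \<ge> 0" "p \<mu> j \<ge> 0" for j using assms by (auto simp: p_def)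
  have w: "(\<Sum>i\<le>n. p \<theta> i * p \<mu> (n - i)) = p (\<theta> + \<mu>) n" for n
    unfolding p_def by (rule poisson_weights_convolution)
  have prod_suminf: "(\<Sum>i. a i) * (\<Sum>j. b j) = (\<Sum>i. \<Sum>j. a i * b j)" for a b :: "nat \<Rightarrow> ennreal"
    by simp
  note dens = ennreal_noncentral_gamma_density[OF assms(1,3), folded p_def]
    ennreal_noncentral_gamma_density[OF assms(2,4), folded p_def]
  have "(\<integral>\<^sup>+y. ennreal (noncentral_gamma_density M \<theta> (x - y)) * ennreal (noncentral_gamma_density N \<mu> y) \<partial>lborel) =
    (\<integral>\<^sup>+y. (\<Sum>i. \<Sum>j. ennreal (p \<theta> i * p \<mu> j) *
       (ennreal (gamma_density (M + real i) (x - y)) * ennreal (gamma_density (N + real j) y))) \<partial>lborel)"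
    unfolding dens prod_suminf using p by (simp only: ennreal_mult mult_ac)
  also have "\<dots> = (\<Sum>i. \<Sum>j. ennreal (p \<theta> i * p \<mu> j) *
      (\<integral>\<^sup>+y. ennreal (gamma_density (M + real i) (x - y)) * ennreal (gamma_density (N + real j) y) \<partial>lborel))"
    by (simp add: nn_integral_suminf nn_integral_cmult)
  also have "\<dots> = (\<Sum>i. \<Sum>j. ennreal (p \<theta> i * p \<mu> j) * ennreal (gamma_density (M + N + real (i + j)) x))"
    using assms by (simp add: gamma_density_convolution add_ac)
  also have "\<dots> = (\<Sum>n. \<Sum>i\<le>n. ennreal (p \<theta> i * p \<mu> (n - i)) * ennreal (gamma_density (M + N + real n) x))"
    by (subst suminf_antidiagonal_ennreal) simp
  also have "\<dots> = (\<Sum>n. ennreal (\<Sum>i\<le>n. p \<theta> i * p \<mu> (n - i)) * ennreal (gamma_density (M + N + real n) x))"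
    using p by (simp add: sum_ennreal sum_distrib_right[symmetric])
  also have "\<dots> = ennreal (noncentral_gamma_density (M + N) (\<theta> + \<mu>) x)"
    using ennreal_noncentral_gamma_density[of "M + N" "\<theta> + \<mu>" x, folded p_def] assms by (simp add: w)
  finally show ?thesis .
qed

section \<open>Squares of normal variables and their sums\<close>

text \<open>At shape 1/2 the series is \<open>cosh (a * z)\<close> up to \<open>sqrt pi\<close>,
  because \<open>Gamma (1 / 2 + j)\<close> is \<open>pochhammer (1 / 2) j * sqrt pi\<close> and
  \<open>fact (2 * j)\<close> is \<open>4 ^ j * pochhammer (1 / 2) j * fact j\<close>. The factor
  \<open>z\<close> is the Jacobian of half the square; the right side is the density of the absolute
  value of a normal variable with mean \<open>a\<close>.\<close>

lemma noncentral_gamma_density_half_square: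
  assumes "z > 0"
  shows "noncentral_gamma_density (1 / 2) (a\<^sup>2 / 2) (z\<^sup>2 / 2) * z = normal_density a 1 z + normal_density a 1 (- z)"
proof -
  have "(\<lambda>n. if even n then (a * z) ^ n /\<^sub>R fact n else 0) sums cosh (a * z)"
    by (rule cosh_converges)
  \<comment> \<open>The series of \<open>cosh\<close> has zeros at odd indices; reindexing along
    \<open>j \<mapsto> 2 * j\<close> drops them.\<close>
  then have "(\<lambda>j. if even (2 * j) then (a * z) ^ (2 * j) /\<^sub>R fact (2 * j) else 0) sums cosh (a * z)"
    by (subst sums_mono_reindex) (auto simp: strict_mono_def elim!: evenE)
  then have cosh: "(\<lambda>j. (a * z) ^ (2 * j) / fact (2 * j)) sums cosh (a * z)"
    by (simp add: divide_inverse mult_ac)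
  have "(a\<^sup>2 / 2 * (z\<^sup>2 / 2)) ^ j / (fact j * Gamma (1 / 2 + real j)) =
      (a * z) ^ (2 * j) / fact (2 * j) / sqrt pi" for j
  proof -
    have nz: "(1 / 2 :: real) \<notin> \<int>\<^sub>\<le>\<^sub>0" using nonpos_Ints_nonpos[of "1 / 2 :: real"] by auto
    have "Gamma (1 / 2 + real j) = pochhammer (1 / 2) j * sqrt pi"
      using pochhammer_Gamma[OF nz, of j] by (simp add: Gamma_one_half_real)
    moreover have "fact (2 * j) = (4 ^ j * pochhammer (1 / 2) j * fact j :: real)"
      using fact_double[of j, where 'a = real] by (simp add: power_mult)
    moreover have "a\<^sup>2 / 2 * (z\<^sup>2 / 2) = (a * z)\<^sup>2 / 4"
      by (simp add: power_mult_distrib)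
    then have "(a\<^sup>2 / 2 * (z\<^sup>2 / 2)) ^ j = (a * z) ^ (2 * j) / 4 ^ j"
      by (simp only: power_mult power_divide)
    ultimately show ?thesis by (simp add: mult_ac)
  qed
  with sums_divide[OF cosh, of "sqrt pi"]
  have S: "(\<Sum>j. (a\<^sup>2 / 2 * (z\<^sup>2 / 2)) ^ j / (fact j * Gamma (1 / 2 + real j))) = cosh (a * z) / sqrt pi"
    by (simp add: sums_iff)
  have "(z\<^sup>2 / 2) powr (1 / 2 - 1) = inverse ((z\<^sup>2 / 2) powr (1 / 2))"
    by (simp add: powr_minus[symmetric])
  then have p: "(z\<^sup>2 / 2) powr (1 / 2 - 1) = sqrt 2 / z"
    using assms by (simp add: powr_half_sqrt real_sqrt_divide)
  have "noncentral_gamma_density (1 / 2) (a\<^sup>2 / 2) (z\<^sup>2 / 2) * z =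
      exp (- (a\<^sup>2 / 2)) * exp (- (z\<^sup>2 / 2)) * (sqrt 2 / sqrt pi) * cosh (a * z)"
    using noncentral_gamma_density_pos[of "z\<^sup>2 / 2" "1 / 2" "a\<^sup>2 / 2", unfolded S p] assms by simp
  also have "sqrt 2 / sqrt pi = 2 / sqrt (2 * pi)"
    by (simp add: real_sqrt_mult field_simps)
  also have "exp (- (a\<^sup>2 / 2)) * exp (- (z\<^sup>2 / 2)) * (2 / sqrt (2 * pi)) * cosh (a * z) =
      (exp (- (a\<^sup>2 / 2)) * exp (- (z\<^sup>2 / 2)) * exp (a * z) +
       exp (- (a\<^sup>2 / 2)) * exp (- (z\<^sup>2 / 2)) * exp (- (a * z))) / sqrt (2 * pi)"
    by (simp add: cosh_def field_simps)
  also have "\<dots> = normal_density a 1 z + normal_density a 1 (- z)"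
    unfolding normal_density_def
    by (simp add: exp_add[symmetric] power2_eq_square field_simps)
  finally show ?thesis .
qed

lemma nn_integral_lborel_fold_halflines:
  fixes f :: "real \<Rightarrow> ennreal"
  assumes [measurable]: "f \<in> borel_measurable borel"
  shows "(\<integral>\<^sup>+x. f x \<partial>lborel) = (\<integral>\<^sup>+x. (f x + f (- x)) * indicator {0<..} x \<partial>lborel)"
proof -
  have "(\<integral>\<^sup>+x. f x \<partial>lborel) = (\<integral>\<^sup>+x. f x * indicator {0<..} x + f x * indicator {..<0} x \<partial>lborel)"
    by (intro nn_integral_cong_AE eventually_mono[OF AE_lborel_singleton[of 0]])
      (auto simp: indicator_def)
  also have "\<dots> = (\<integral>\<^sup>+x. f x * indicator {0<..} x \<partial>lborel) + (\<integral>\<^sup>+x. f x * indicator {..<0} x \<partial>lborel)"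
    by (rule nn_integral_add) auto
  also have "(\<integral>\<^sup>+x. f x * indicator {..<0} x \<partial>lborel) = (\<integral>\<^sup>+x. f (- x) * indicator {..<0} (- x) \<partial>lborel)"
    by (subst nn_integral_real_affine[where c = "-1" and t = 0]) auto
  also have "\<dots> = (\<integral>\<^sup>+x. f (- x) * indicator {0<..} x \<partial>lborel)"
    by (intro nn_integral_cong) (auto simp: indicator_def)
  also have "(\<integral>\<^sup>+x. f x * indicator {0<..} x \<partial>lborel) + (\<integral>\<^sup>+x. f (- x) * indicator {0<..} x \<partial>lborel) =
      (\<integral>\<^sup>+x. (f x + f (- x)) * indicator {0<..} x \<partial>lborel)"
    by (subst nn_integral_add[symmetric]) (auto simp: distrib_right)
  finally show ?thesis .
qed

text \<open>Squaring is two-to-one, so the integral over each Borel set is first folded onto the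
  positive half-line, where half the square is a bijection and the substitution applies.\<close>

lemma distributed_half_square_normal:
  assumes Z: "distributed P lborel Z (normal_density a 1)"
  shows "distributed P lborel (\<lambda>\<omega>. (Z \<omega>)\<^sup>2 / 2) (noncentral_gamma_density (1 / 2) (a\<^sup>2 / 2))"
  unfolding distributed_def
proof (intro conjI)
  have [measurable]: "Z \<in> borel_measurable P" using distributed_measurable[OF Z] by simp
  show "(\<lambda>\<omega>. (Z \<omega>)\<^sup>2 / 2) \<in> measurable P lborel" by simp
  show "distr P lborel (\<lambda>\<omega>. (Z \<omega>)\<^sup>2 / 2) = density lborel (noncentral_gamma_density (1 / 2) (a\<^sup>2 / 2))"
  proof (rule measure_eqI)
    fix A assume "A \<in> sets (distr P lborel (\<lambda>\<omega>. (Z \<omega>)\<^sup>2 / 2))"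
    then have [measurable]: "A \<in> sets borel" by simp
    let ?n = "noncentral_gamma_density (1 / 2) (a\<^sup>2 / 2)"
    have nn: "?n x \<ge> 0" for x by (rule noncentral_gamma_density_nonneg) auto
    have "emeasure (distr P lborel (\<lambda>\<omega>. (Z \<omega>)\<^sup>2 / 2)) A = (\<integral>\<^sup>+\<omega>. indicator A ((Z \<omega>)\<^sup>2 / 2) \<partial>P)"
      by (subst nn_integral_indicator[symmetric], simp, subst nn_integral_distr) auto
    also have "\<dots> = (\<integral>\<^sup>+z. ennreal (normal_density a 1 z) * indicator A (z\<^sup>2 / 2) \<partial>lborel)"
      by (subst distributed_nn_integral[OF Z, of "\<lambda>z. indicator A (z\<^sup>2 / 2)"]) auto
    also have "\<dots> = (\<integral>\<^sup>+z. (ennreal (normal_density a 1 z) * indicator A (z\<^sup>2 / 2) +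
        ennreal (normal_density a 1 (- z)) * indicator A ((- z)\<^sup>2 / 2)) * indicator {0<..} z \<partial>lborel)"
      by (rule nn_integral_lborel_fold_halflines) simp
    also have "\<dots> = (\<integral>\<^sup>+z. ennreal (?n (z\<^sup>2 / 2) * indicator A (z\<^sup>2 / 2) * z) * indicator {0<..} z \<partial>lborel)"
    proof (intro nn_integral_cong)
      fix z :: real
      show "(ennreal (normal_density a 1 z) * indicator A (z\<^sup>2 / 2) +
          ennreal (normal_density a 1 (- z)) * indicator A ((- z)\<^sup>2 / 2)) * indicator {0<..} z =
          ennreal (?n (z\<^sup>2 / 2) * indicator A (z\<^sup>2 / 2) * z) * indicator {0<..} z"
      proof (cases "z > 0 \<and> z\<^sup>2 / 2 \<in> A")
        case True
        then show ?thesis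
          using noncentral_gamma_density_half_square[of z a] by (simp add: ennreal_plus[symmetric] del: ennreal_plus)
      qed (auto simp: indicator_def)
    qed
    also have "\<dots> = (\<integral>\<^sup>+x. ennreal (?n x * indicator A x) * indicator {0<..} x \<partial>lborel)"
      by (rule nn_integral_half_square_substitution[symmetric]) (auto simp: nn)
    also have "\<dots> = (\<integral>\<^sup>+x. ennreal (?n x) * indicator A x \<partial>lborel)"
    proof (intro nn_integral_cong)
      fix x :: real
      show "ennreal (?n x * indicator A x) * indicator {0<..} x = ennreal (?n x) * indicator A x"
        using noncentral_gamma_density_nonpos[of x] by (cases "x > 0") (auto simp: indicator_def)
    qed
    also have "\<dots> = emeasure (density lborel ?n) A"
      by (subst emeasure_density) auto
    finally show "emeasure (distr P lborel (\<lambda>\<omega>. (Z \<omega>)\<^sup>2 / 2)) A = emeasure (density lborel ?n) A" .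
  qed simp
qed simp

text \<open>Induction on \<open>I\<close> with one convolution per step. It starts at a singleton,
  since the empty sum is a point mass and has no density.\<close>

lemma (in prob_space) distributed_sum_noncentral_gamma_density:
  assumes "finite I" "I \<noteq> {}" "indep_vars (\<lambda>_. borel) W I"
    and "\<And>i. i \<in> I \<Longrightarrow> k i > 0" "\<And>i. i \<in> I \<Longrightarrow> \<theta> i \<ge> 0"
    and "\<And>i. i \<in> I \<Longrightarrow> distributed M lborel (W i) (noncentral_gamma_density (k i) (\<theta> i))"
  shows "distributed M lborel (\<lambda>\<omega>. \<Sum>i\<in>I. W i \<omega>) (noncentral_gamma_density (\<Sum>i\<in>I. k i) (\<Sum>i\<in>I. \<theta> i))"
  using assms
proof (induction I rule: finite_ne_induct)
  case (insert i I)
  have ind: "indep_var borel (W i) borel (\<lambda>\<omega>. \<Sum>i\<in>I. W i \<omega>)"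
    using insert by (intro indep_vars_sum) auto
  have IH: "distributed M lborel (\<lambda>\<omega>. \<Sum>i\<in>I. W i \<omega>) (noncentral_gamma_density (sum k I) (sum \<theta> I))"
    using insert.prems by (intro insert.IH) (auto intro: indep_vars_subset)
  have pos: "sum k I > 0" "sum \<theta> I \<ge> 0" "k i > 0" "\<theta> i \<ge> 0"
    using insert by (auto intro!: sum_pos sum_nonneg)
  have "distributed M lborel (W i) (noncentral_gamma_density (k i) (\<theta> i))"
    using insert.prems by simp
  from distributed_convolution[OF ind this IH] show ?case
    using insert.hyps pos by (simp add: noncentral_gamma_density_convolution)
qed simp

section \<open>Product densities on Euclidean space and independent coordinates\<close>

text \<open>Transfers the product formula over \<open>Basis\<close> to coordinates: the basis
  vectors are the axis vectors, and \<open>inv ?ax\<close> recovers the index of each.\<close>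

lemma nn_integral_lborel_vec_prod:
  fixes f :: "'n::finite \<Rightarrow> real \<Rightarrow> ennreal"
  assumes "\<And>i. f i \<in> borel_measurable borel"
  shows "(\<integral>\<^sup>+x. (\<Prod>i\<in>UNIV. f i (x $ i)) \<partial>(lborel :: (real ^ 'n) measure)) =
    (\<Prod>i\<in>UNIV. (\<integral>\<^sup>+x. f i x \<partial>lborel))"
proof -
  let ?ax = "\<lambda>i::'n. axis i (1::real)"
  have inj: "inj ?ax" by (auto simp: inj_on_def axis_eq_axis)
  have B: "(Basis :: (real ^ 'n) set) = range ?ax" by (auto simp: Basis_vec_def)
  have "(\<integral>\<^sup>+x. (\<Prod>b\<in>Basis. f (inv ?ax b) (x \<bullet> b)) \<partial>(lborel :: (real ^ 'n) measure)) =
    (\<Prod>b\<in>(Basis :: (real ^ 'n) set). (\<integral>\<^sup>+x. f (inv ?ax b) x \<partial>lborel))"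
    using assms by (intro nn_integral_lborel_prod) auto
  then show ?thesis
    using inj by (simp add: B prod.reindex inner_axis inv_f_f[OF inj])
qed

context prob_space
begin

context
  fixes Y :: "'a \<Rightarrow> real ^ 'n" and f :: "'n \<Rightarrow> real \<Rightarrow> ennreal"
  assumes Y: "distributed M lborel Y (\<lambda>y. \<Prod>i\<in>UNIV. f i (y $ i))"
    and f [measurable]: "\<And>i. f i \<in> borel_measurable borel"
    and f_int: "\<And>i. (\<integral>\<^sup>+x. f i x \<partial>lborel) = 1"
begin

text \<open>The indicator of a box is a product of one-dimensional indicators, so the integral
  factorises. Both the marginal laws and the independence follow from this formula.\<close>

lemma emeasure_box_product_density:
  assumes [measurable]: "\<And>i. A i \<in> sets borel"
  shows "emeasure M {\<omega> \<in> space M. \<forall>i. Y \<omega> $ i \<in> A i} = (\<Prod>i\<in>UNIV. \<integral>\<^sup>+x. f i x * indicator (A i) x \<partial>lborel)"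
proof -
  have "{\<omega> \<in> space M. \<forall>i. Y \<omega> $ i \<in> A i} = Y -` {y. \<forall>i. y $ i \<in> A i} \<inter> space M" by auto
  moreover have "{y :: real ^ 'n. \<forall>i. y $ i \<in> A i} \<in> sets lborel" by measurable
  ultimately have "emeasure M {\<omega> \<in> space M. \<forall>i. Y \<omega> $ i \<in> A i} =
      (\<integral>\<^sup>+y. (\<Prod>i\<in>UNIV. f i (y $ i)) * indicator {y. \<forall>i. y $ i \<in> A i} y \<partial>lborel)"
    using distributed_emeasure[OF Y] by (simp only:)
  also have "\<dots> = (\<integral>\<^sup>+y. (\<Prod>i\<in>UNIV. f i (y $ i) * indicator (A i) (y $ i)) \<partial>lborel)"
  proof (intro nn_integral_cong)
    fix y :: "real ^ 'n"
    have "(\<Prod>i\<in>UNIV. indicator (A i) (y $ i)) = (indicator {y. \<forall>i. y $ i \<in> A i} y :: ennreal)"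
      by (auto simp: indicator_def)
    then show "(\<Prod>i\<in>UNIV. f i (y $ i)) * indicator {y. \<forall>i. y $ i \<in> A i} y =
        (\<Prod>i\<in>UNIV. f i (y $ i) * indicator (A i) (y $ i))"
      by (simp add: prod.distrib)
  qed
  also have "\<dots> = (\<Prod>i\<in>UNIV. \<integral>\<^sup>+x. f i x * indicator (A i) x \<partial>lborel)"
    by (rule nn_integral_lborel_vec_prod) simp
  finally show ?thesis .
qed

lemma measurable_component_product_density [measurable]: "(\<lambda>\<omega>. Y \<omega> $ i) \<in> borel_measurable M"
proof -
  have [measurable]: "Y \<in> borel_measurable M" using distributed_measurable[OF Y] by simp
  have "(\<lambda>y :: real ^ 'n. y $ i) \<in> borel_measurable borel"
    by (intro borel_measurable_continuous_onI continuous_intros)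
  then show ?thesis by measurable
qed

lemma emeasure_component_product_density:
  assumes "A \<in> sets borel"
  shows "emeasure M {\<omega> \<in> space M. Y \<omega> $ i \<in> A} = (\<integral>\<^sup>+x. f i x * indicator A x \<partial>lborel)"
proof -
  \<comment> \<open>A box unrestricted in all other coordinates, each of which contributes the
    factor 1 by \<open>f_int\<close>.\<close>
  let ?A = "\<lambda>j. if j = i then A else UNIV"
  have "{\<omega> \<in> space M. Y \<omega> $ i \<in> A} = {\<omega> \<in> space M. \<forall>j. Y \<omega> $ j \<in> ?A j}"
    by auto
  also have "emeasure M \<dots> = (\<Prod>j\<in>UNIV. \<integral>\<^sup>+x. f j x * indicator (?A j) x \<partial>lborel)"
    using assms by (intro emeasure_box_product_density) auto
  also have "\<dots> = (\<Prod>j\<in>UNIV. if j = i then \<integral>\<^sup>+x. f i x * indicator A x \<partial>lborel else 1)"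
    by (intro prod.cong) (auto simp: f_int)
  also have "\<dots> = (\<integral>\<^sup>+x. f i x * indicator A x \<partial>lborel)" by simp
  finally show ?thesis .
qed

lemma distributed_component_product_density: "distributed M lborel (\<lambda>\<omega>. Y \<omega> $ i) (f i)"
  unfolding distributed_def
proof (intro conjI)
  show "distr M lborel (\<lambda>\<omega>. Y \<omega> $ i) = density lborel (f i)"
  proof (rule measure_eqI)
    fix A assume "A \<in> sets (distr M lborel (\<lambda>\<omega>. Y \<omega> $ i))"
    then have [measurable]: "A \<in> sets borel" by simp
    have "emeasure (distr M lborel (\<lambda>\<omega>. Y \<omega> $ i)) A = emeasure M {\<omega> \<in> space M. Y \<omega> $ i \<in> A}"
      by (subst emeasure_distr) (auto simp: vimage_def Int_def conj_commute)
    then show "emeasure (distr M lborel (\<lambda>\<omega>. Y \<omega> $ i)) A = emeasure (density lborel (f i)) A"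
      by (simp add: emeasure_component_product_density emeasure_density)
  qed simp
qed simp_all

text \<open>Independence amounts to the joint law being the product of the marginals, and for that
  it suffices to compare both on boxes.\<close>

lemma indep_vars_components_product_density: "indep_vars (\<lambda>_. borel) (\<lambda>i \<omega>. Y \<omega> $ i) UNIV"
proof -
  let ?D = "\<lambda>i. distr M borel (\<lambda>\<omega>. Y \<omega> $ i)"
  \<comment> \<open>Bound before the interpretation, so that these facts keep speaking of
    \<open>M\<close>.\<close>
  note box = emeasure_box_product_density and component = emeasure_component_product_density
  note indep_iff = indep_vars_iff_distr_eq_PiM
  interpret product_prob_space ?D UNIV
    by (intro product_prob_spaceI prob_space_distr) simp
  have "distr M (\<Pi>\<^sub>M i\<in>UNIV. borel) (\<lambda>\<omega>. \<lambda>i\<in>UNIV. Y \<omega> $ i) = Pi\<^sub>M UNIV ?D"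
  proof (rule PiM_eqI)
    show "sets (distr M (\<Pi>\<^sub>M i\<in>UNIV. borel) (\<lambda>\<omega>. \<lambda>i\<in>UNIV. Y \<omega> $ i)) = sets (Pi\<^sub>M UNIV ?D)"
      by (simp cong: sets_PiM_cong)
    fix A :: "'n \<Rightarrow> real set"
    assume "\<And>i. i \<in> UNIV \<Longrightarrow> A i \<in> sets (?D i)"
    then have A [measurable]: "A i \<in> sets borel" for i by simp
    have "Pi\<^sub>E UNIV A \<in> sets (\<Pi>\<^sub>M i\<in>UNIV. borel)" by (intro sets_PiM_I_finite) auto
    then have "emeasure (distr M (\<Pi>\<^sub>M i\<in>UNIV. borel) (\<lambda>\<omega>. \<lambda>i\<in>UNIV. Y \<omega> $ i)) (Pi\<^sub>E UNIV A) =
        emeasure M {\<omega> \<in> space M. \<forall>i. Y \<omega> $ i \<in> A i}"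
      by (subst emeasure_distr) (auto intro!: arg_cong[where f = "emeasure M"] measurable_restrict)
    also have "\<dots> = (\<Prod>i\<in>UNIV. \<integral>\<^sup>+x. f i x * indicator (A i) x \<partial>lborel)"
      by (rule box) simp
    also have "\<dots> = (\<Prod>i\<in>UNIV. emeasure (?D i) (A i))"
      by (intro prod.cong refl)
        (simp add: emeasure_distr component[symmetric] vimage_def Int_def conj_commute)
    finally show "emeasure (distr M (\<Pi>\<^sub>M i\<in>UNIV. borel) (\<lambda>\<omega>. \<lambda>i\<in>UNIV. Y \<omega> $ i)) (Pi\<^sub>E UNIV A) =
        (\<Prod>i\<in>UNIV. emeasure (?D i) (A i))" .
  qed simp
  then show ?thesis
    by (subst indep_iff) auto
qed

end

end

section \<open>The Bessel series and the Marcum function\<close>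

text \<open>For positive \<open>t\<close>, \<open>rpow\<close> agrees with \<open>powr\<close>, so
  the power \<open>M - 1\<close> splits off and leaves the series of
  \<open>noncentral_gamma_density_pos\<close>.\<close>

lemma bessel_I_series:
  assumes "M > 0" "t > 0"
  shows "bessel_I (M - 1) t = (t / 2) powr (M - 1) * (\<Sum>j. ((t / 2)\<^sup>2) ^ j / (fact j * Gamma (M + real j)))"
proof -
  have "rpow (t / 2) (2 * real j + (M - 1)) * rGamma (M - 1 + real j + 1) / fact j =
      (t / 2) powr (M - 1) * (((t / 2)\<^sup>2) ^ j / (fact j * Gamma (M + real j)))" for j
  proof -
    have "rpow (t / 2) (2 * real j + (M - 1)) = (t / 2) powr (real (2 * j) + (M - 1))"
      using assms by (simp add: rpow_def)
    also have "\<dots> = ((t / 2)\<^sup>2) ^ j * (t / 2) powr (M - 1)"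
      using assms by (simp only: powr_add powr_realpow power_mult half_gt_zero)
    finally have r: "rpow (t / 2) (2 * real j + (M - 1)) = ((t / 2)\<^sup>2) ^ j * (t / 2) powr (M - 1)" .
    have g: "rGamma (M - 1 + real j + 1) = inverse (Gamma (M + real j))"
      by (simp add: rGamma_inverse_Gamma)
    show ?thesis
      unfolding r g by (simp only: divide_inverse inverse_mult_distrib mult_ac)
  qed
  then have "bessel_I (M - 1) t = (\<Sum>j. (t / 2) powr (M - 1) * (((t / 2)\<^sup>2) ^ j / (fact j * Gamma (M + real j))))"
    by (simp add: bessel_I_def)
  also have "\<dots> = (t / 2) powr (M - 1) * (\<Sum>j. ((t / 2)\<^sup>2) ^ j / (fact j * Gamma (M + real j)))"
    using assms by (intro suminf_mult summable_power_div_fact_Gamma) auto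
  finally show ?thesis .
qed

text \<open>Both sides contain the same series \<open>S\<close>, because the square of
  \<open>\<alpha> * x / 2\<close> is the product of the parameter and the argument of the mixture.
  The factor \<open>x\<close> is again a Jacobian.\<close>

lemma noncentral_gamma_density_eq_bessel_I:
  assumes "M > 0" "\<alpha> > 0" "x > 0"
  shows "noncentral_gamma_density M (\<alpha>\<^sup>2 / 2) (x\<^sup>2 / 2) * x =
    1 / \<alpha> powr (M - 1) * (x powr M * exp (- (x\<^sup>2 + \<alpha>\<^sup>2) / 2) * bessel_I (M - 1) (\<alpha> * x))"
proof -
  define S where "S = (\<Sum>j. ((\<alpha> * x / 2)\<^sup>2) ^ j / (fact j * Gamma (M + real j)))"
  have q: "(\<alpha> * x / 2)\<^sup>2 = \<alpha>\<^sup>2 / 2 * (x\<^sup>2 / 2)" by (simp add: power2_eq_square)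
  have n: "noncentral_gamma_density M (\<alpha>\<^sup>2 / 2) (x\<^sup>2 / 2) =
      exp (- (\<alpha>\<^sup>2 / 2)) * exp (- (x\<^sup>2 / 2)) * (x\<^sup>2 / 2) powr (M - 1) * S"
    unfolding S_def q by (rule noncentral_gamma_density_pos) (use assms in auto)
  have b: "bessel_I (M - 1) (\<alpha> * x) = (\<alpha> * x / 2) powr (M - 1) * S"
    unfolding S_def by (rule bessel_I_series) (use assms in auto)
  \<comment> \<open>Split so that \<open>(x / 2) powr (M - 1)\<close> is common to both sides; what
    remains on the Bessel side is \<open>\<alpha> powr (M - 1)\<close>, cancelled by the
    prefactor.\<close>
  have "(x\<^sup>2 / 2) powr (M - 1) = (x * (x / 2)) powr (M - 1)" by (simp add: power2_eq_square)
  also have "\<dots> = x powr (M - 1) * (x / 2) powr (M - 1)" by (rule powr_mult)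
  finally have p1: "(x\<^sup>2 / 2) powr (M - 1) = x powr (M - 1) * (x / 2) powr (M - 1)" .
  have "(\<alpha> * x / 2) powr (M - 1) = (\<alpha> * (x / 2)) powr (M - 1)" by simp
  also have "\<dots> = \<alpha> powr (M - 1) * (x / 2) powr (M - 1)" by (rule powr_mult)
  finally have p2: "(\<alpha> * x / 2) powr (M - 1) = \<alpha> powr (M - 1) * (x / 2) powr (M - 1)" .
  have p3: "x powr M = x * x powr (M - 1)" using assms powr_mult_base[of x "M - 1"] by simp
  have e: "exp (- (x\<^sup>2 + \<alpha>\<^sup>2) / 2) = exp (- (\<alpha>\<^sup>2 / 2)) * exp (- (x\<^sup>2 / 2))"
    by (simp add: exp_add[symmetric] field_simps)
  show ?thesis
    unfolding n b p1 p2 p3 e using assms by simp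
qed

text \<open>Only the Poisson weight at 0 survives. This matches the separate clause of
  \<open>marcum_Q\<close> for \<open>\<alpha> = 0\<close>.\<close>

lemma noncentral_gamma_density_zero: "noncentral_gamma_density M 0 = gamma_density M"
proof
  show "noncentral_gamma_density M 0 y = gamma_density M y" for y
    unfolding noncentral_gamma_density_def by (subst suminf_finite[of "{0}"]) (auto simp: power_0_left)
qed

lemma borel_measurable_bessel_I [measurable]: "bessel_I \<nu> \<in> borel_measurable borel"
proof -
  have [measurable]: "(\<lambda>t. rpow t a) \<in> borel_measurable borel" for a
    unfolding rpow_def by measurable
  show ?thesis unfolding bessel_I_def by measurable
qed

text \<open>Bridge from the Bochner integrals in \<open>marcum_Q\<close> to nonnegative integrals.
  The endpoint \<open>b\<close> is null, so values there, such as those of \<open>powr\<close> at 0,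
  do not matter. An infinite integral is sent to 0 on both sides.\<close>

lemma set_integral_eq_enn2real_nn_integral:
  fixes f g :: "real \<Rightarrow> real"
  assumes [measurable]: "f \<in> borel_measurable borel" "g \<in> borel_measurable borel"
    and "\<And>x. x > b \<Longrightarrow> f x = g x" "\<And>x. x > b \<Longrightarrow> g x \<ge> 0"
  shows "(LBINT x:{b..}. f x) = enn2real (\<integral>\<^sup>+x. ennreal (g x) * indicator {b<..} x \<partial>lborel)"
proof -
  have ae: "AE x in lborel. x \<noteq> b" by (rule AE_lborel_singleton)
  have "(LBINT x:{b..}. f x) = (\<integral>x. g x * indicator {b<..} x \<partial>lborel)"
    unfolding set_lebesgue_integral_def using ae assms(3)
    by (intro integral_cong_AE) (auto elim!: eventually_mono simp: indicator_def)
  also have "\<dots> = enn2real (\<integral>\<^sup>+x. ennreal (g x * indicator {b<..} x) \<partial>lborel)"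
    using assms(4) by (intro integral_eq_nn_integral) (auto simp: indicator_def)
  also have "(\<integral>\<^sup>+x. ennreal (g x * indicator {b<..} x) \<partial>lborel) =
      (\<integral>\<^sup>+x. ennreal (g x) * indicator {b<..} x \<partial>lborel)"
    by (intro nn_integral_cong) (auto simp: indicator_def)
  finally show ?thesis .
qed

lemma marcum_Q_eq_noncentral_gamma_density_tail:
  assumes "M > 0" "\<alpha> \<ge> 0" "\<beta> \<ge> 0"
  shows "marcum_Q M \<alpha> \<beta> =
    enn2real (\<integral>\<^sup>+x. ennreal (noncentral_gamma_density M (\<alpha>\<^sup>2 / 2) x) * indicator {\<beta>\<^sup>2 / 2<..} x \<partial>lborel)"
proof (cases "\<alpha> = 0")
  case True
  have "marcum_Q M \<alpha> \<beta> = (LBINT u:{\<beta>\<^sup>2 / 2..}. u powr (M - 1) * exp (- u) / Gamma M)"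
    using True by (simp add: marcum_Q_def upper_incomplete_Gamma_def)
  also have "\<dots> = enn2real (\<integral>\<^sup>+x. ennreal (gamma_density M x) * indicator {\<beta>\<^sup>2 / 2<..} x \<partial>lborel)"
  proof (rule set_integral_eq_enn2real_nn_integral)
    fix x assume "x > \<beta>\<^sup>2 / 2"
    moreover have "\<beta>\<^sup>2 / 2 \<ge> 0" by simp
    ultimately have "x > 0" by linarith
    then show "x powr (M - 1) * exp (- x) / Gamma M = gamma_density M x"
      by (simp add: gamma_density_def)
  qed (use assms in \<open>auto simp: gamma_density_nonneg\<close>)
  finally show ?thesis using True by (simp add: noncentral_gamma_density_zero)
next
  case False
  let ?n = "noncentral_gamma_density M (\<alpha>\<^sup>2 / 2)"
  let ?B = "\<lambda>x. 1 / \<alpha> powr (M - 1) * (x powr M * exp (- (x\<^sup>2 + \<alpha>\<^sup>2) / 2) * bessel_I (M - 1) (\<alpha> * x))"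
  have nn: "?n x \<ge> 0" for x using assms by (intro noncentral_gamma_density_nonneg) auto
  have "marcum_Q M \<alpha> \<beta> = (LBINT x:{\<beta>..}. ?B x)"
    using False unfolding marcum_Q_def by (subst set_integral_mult_right) auto
  also have "\<dots> = enn2real (\<integral>\<^sup>+x. ennreal (?n (x\<^sup>2 / 2) * x) * indicator {\<beta><..} x \<partial>lborel)"
  proof (rule set_integral_eq_enn2real_nn_integral)
    fix x assume "x > \<beta>"
    then have "x > 0" using assms by simp
    then show "?B x = ?n (x\<^sup>2 / 2) * x"
      using False assms by (intro noncentral_gamma_density_eq_bessel_I[symmetric]) auto
    show "0 \<le> ?n (x\<^sup>2 / 2) * x" using nn \<open>x > 0\<close> by simp
  qed auto
  \<comment> \<open>The tail indicator becomes part of the function to be substituted; since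
    \<open>\<beta> \<ge> 0\<close>, the threshold \<open>\<beta>\<close> for \<open>x\<close> is
    \<open>\<beta>\<^sup>2 / 2\<close> for half the square.\<close>
  also have "(\<integral>\<^sup>+x. ennreal (?n (x\<^sup>2 / 2) * x) * indicator {\<beta><..} x \<partial>lborel) =
      (\<integral>\<^sup>+x. ennreal (?n (x\<^sup>2 / 2) * indicator {\<beta>\<^sup>2 / 2<..} (x\<^sup>2 / 2) * x) * indicator {0<..} x \<partial>lborel)"
  proof (intro nn_integral_cong)
    fix x :: real
    have "\<beta>\<^sup>2 / 2 < x\<^sup>2 / 2 \<longleftrightarrow> \<beta> < x" if "x > 0"
      using that assms by (simp add: power_mono_iff abs_le_square_iff not_le[symmetric])
    then show "ennreal (?n (x\<^sup>2 / 2) * x) * indicator {\<beta><..} x =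
        ennreal (?n (x\<^sup>2 / 2) * indicator {\<beta>\<^sup>2 / 2<..} (x\<^sup>2 / 2) * x) * indicator {0<..} x"
      using assms by (auto simp: indicator_def)
  qed
  also have "\<dots> = (\<integral>\<^sup>+x. ennreal (?n x * indicator {\<beta>\<^sup>2 / 2<..} x) * indicator {0<..} x \<partial>lborel)"
    by (rule nn_integral_half_square_substitution[symmetric]) (auto simp: nn)
  also have "\<dots> = (\<integral>\<^sup>+x. ennreal (?n x) * indicator {\<beta>\<^sup>2 / 2<..} x \<partial>lborel)"
  proof (intro nn_integral_cong)
    fix x :: real
    show "ennreal (?n x * indicator {\<beta>\<^sup>2 / 2<..} x) * indicator {0<..} x =
        ennreal (?n x) * indicator {\<beta>\<^sup>2 / 2<..} x"
      using noncentral_gamma_density_nonpos[of x] by (cases "x > 0") (auto simp: indicator_def)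
  qed
  finally show ?thesis .
qed

section \<open>The tail of the norm of a shifted isotropic Gaussian vector\<close>

theorem proposition4p3:
  fixes P :: "'a measure"
    and X :: "real ^ 'm"
    and Y :: "'a \<Rightarrow> real ^ 'm"
    and \<sigma> \<epsilon> :: real
  assumes "prob_space P"
    and "\<sigma> > 0"
    and "distributed P lborel Y (multivariate_normal_density 0 (\<sigma>\<^sup>2 *\<^sub>R mat 1))"
    and "\<epsilon> \<ge> 0"
  shows "measure P {\<omega> \<in> space P. norm (X + Y \<omega>) > \<epsilon>} =
         marcum_Q (real CARD('m) / 2) (norm X / \<sigma>) (\<epsilon> / \<sigma>)"
proof -
  interpret prob_space P by fact
  \<comment> \<open>The affine form is that of \<open>normal_density_affine\<close>: the squared
    variable is normal with mean \<open>X $ i / \<sigma>\<close> and variance 1.\<close>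
  define W where "W i \<omega> = (X $ i / \<sigma> + 1 / \<sigma> * Y \<omega> $ i)\<^sup>2 / 2" for i \<omega>
  define f where "f = (\<lambda>(i::'m) x. ennreal (normal_density 0 \<sigma> x))"
  have Y: "distributed P lborel Y (\<lambda>y. \<Prod>i\<in>UNIV. f i (y $ i))"
    using assms(2,3) by (simp add: multivariate_normal_density_isotropic f_def prod_ennreal)
  have fm: "f i \<in> borel_measurable borel" for i by (simp add: f_def)
  have f1: "(\<integral>\<^sup>+x. f i x \<partial>lborel) = 1" for i
    using assms(2) by (simp add: f_def nn_integral_eq_integral integral_normal_density)
  have "distributed P lborel (\<lambda>\<omega>. X $ i / \<sigma> + 1 / \<sigma> * Y \<omega> $ i) (normal_density (X $ i / \<sigma>) 1)" for i
    using normal_density_affine[OF distributed_component_product_density[OF Y fm f1, unfolded f_def],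
        of "1 / \<sigma>" "X $ i / \<sigma>"] assms(2) by simp
  then have Wd: "distributed P lborel (W i) (noncentral_gamma_density (1 / 2) ((X $ i / \<sigma>)\<^sup>2 / 2))" for i
    unfolding W_def by (rule distributed_half_square_normal)
  have Wi: "indep_vars (\<lambda>_. borel) W UNIV"
    unfolding W_def by (intro indep_vars_compose2[OF indep_vars_components_product_density[OF Y fm f1]]) simp
  \<comment> \<open>Used twice: at \<open>X + Y \<omega>\<close> for the sum of the
    \<open>W i\<close>, and at \<open>X\<close> for the sum of the Poisson parameters.\<close>
  have square: "(\<Sum>i\<in>UNIV. (v $ i / \<sigma>)\<^sup>2 / 2) = (norm v / \<sigma>)\<^sup>2 / 2" for v :: "real ^ 'm"
    by (simp add: power_divide sum_divide_distrib[symmetric] norm_vec_def L2_set_def sum_nonneg)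
  have "distributed P lborel (\<lambda>\<omega>. \<Sum>i\<in>UNIV. W i \<omega>)
      (noncentral_gamma_density (\<Sum>i\<in>(UNIV::'m set). 1 / 2) (\<Sum>i\<in>UNIV. (X $ i / \<sigma>)\<^sup>2 / 2))"
    using Wi Wd by (intro distributed_sum_noncentral_gamma_density) auto
  moreover have "(\<Sum>i\<in>UNIV. W i \<omega>) = (norm (X + Y \<omega>) / \<sigma>)\<^sup>2 / 2" for \<omega>
    unfolding W_def by (subst square[symmetric]) (simp add: add_divide_distrib)
  ultimately have D: "distributed P lborel (\<lambda>\<omega>. (norm (X + Y \<omega>) / \<sigma>)\<^sup>2 / 2)
      (noncentral_gamma_density (real CARD('m) / 2) ((norm X / \<sigma>)\<^sup>2 / 2))"
    by (simp add: square)
  have iff: "\<epsilon> < norm v \<longleftrightarrow> (\<epsilon> / \<sigma>)\<^sup>2 / 2 < (norm v / \<sigma>)\<^sup>2 / 2" for v :: "real ^ 'm"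
  proof -
    have "\<epsilon> < norm v \<longleftrightarrow> \<epsilon> / \<sigma> < norm v / \<sigma>" using assms(2) by (simp add: divide_less_cancel)
    also have "\<dots> \<longleftrightarrow> (\<epsilon> / \<sigma>)\<^sup>2 < (norm v / \<sigma>)\<^sup>2"
      using assms(2,4) by (auto intro: power_strict_mono dest: power_less_imp_less_base)
    finally show ?thesis by simp
  qed
  have "{\<omega> \<in> space P. norm (X + Y \<omega>) > \<epsilon>} =
      (\<lambda>\<omega>. (norm (X + Y \<omega>) / \<sigma>)\<^sup>2 / 2) -` {(\<epsilon> / \<sigma>)\<^sup>2 / 2<..} \<inter> space P"
    by (intro set_eqI) (simp only: mem_Collect_eq vimage_eq Int_iff greaterThan_iff iff conj_commute)
  then have "emeasure P {\<omega> \<in> space P. norm (X + Y \<omega>) > \<epsilon>} =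
      (\<integral>\<^sup>+x. ennreal (noncentral_gamma_density (real CARD('m) / 2) ((norm X / \<sigma>)\<^sup>2 / 2) x) *
        indicator {(\<epsilon> / \<sigma>)\<^sup>2 / 2<..} x \<partial>lborel)"
    by (simp add: distributed_emeasure[OF D])
  then show ?thesis
    using assms(2,4) by (simp add: measure_def marcum_Q_eq_noncentral_gamma_density_tail)
qed

end
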